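(* Let $V$ be a locally linearly compact vector space over a discrete field $\mathbb{K}$, $\phi:V\to V$ a continuous endomorphism and $U$ a linearly compact open linear subspace of $V$. Let $U_0=U$, $U_{n+1}=U\cap\phi U_n$ for all $n\in\mathbb{N}$, and $U_+=\bigcap_{n\in\mathbb{N}}U_n$. Then $$H^*(\phi,U)=\dim\frac{\phi U_+}{U_+}.$$
   Context: $\mathbb{N}=\{0,1,2,\dots\}$. $\mathbb{K}$ is an arbitrary field with the discrete topology. A Hausdorff topological $\mathbb{K}$-vector space is linearly topologized if it has a neighborhood basis at $0$ consisting of linear subspaces. A linear variety is a coset $v+W$ of a linear subspace $W$; it is closed if $W$ is closed. A linearly topologized vector space is linearly compact if every collection of closed linear varieties with the finite intersection property has non-empty intersection. A topological $\mathbb{K}$-vector space $V$ is locally linearly compact if it has a neighborhood basis at $0$ consisting of linearly compact open linear subspaces. A continuous endomorphism is a continuous $\mathbb{K}$-linear map $V\to V$. For $n\geq 1$ let $C_n(\phi,U)=U\cap\phi^{-1}U\cap\ldots\cap\phi^{-n+1}U$ and $H^*(\phi,U)=\lim_{n\to\infty}\frac{1}{n}\dim\frac{U}{C_n(\phi,U)}$ (this limit exists). One has $U_+\leq\phi U_+$, so the quotient in the claim makes sense. *)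

theory Defs
  imports
    "HOL-Analysis.Analysis"
    "HOL-Library.Extended_Real"
    "Jordan_Normal_Form.VS_Connect"
begin

text \<open>The ground field carries no topological class: its topology is the discrete one,
  which enters only through the joint continuity of the scalar multiplication.\<close>

locale topological_vector_space = vector_space scale
  for scale :: "'k::field \<Rightarrow> 'v::topological_ab_group_add \<Rightarrow> 'v" +
  assumes continuous_scale:
    "continuous_map (prod_topology (discrete_topology (UNIV :: 'k set)) (euclidean :: 'v topology))
       euclidean (\<lambda>(c, v). scale c v)"
begin

text \<open>The following notions concern a linear subspace \<open>U\<close> as a topological vector space in its
  own right, that is, with the subspace topology.\<close>

definition linearly_topologized :: "'v set \<Rightarrow> bool" where
  "linearly_topologized U \<longleftrightarrow>
     subspace U \<and> Hausdorff_space (top_of_set U) \<and>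
     (\<forall>N. openin (top_of_set U) N \<and> 0 \<in> N \<longrightarrow>
       (\<exists>W N'. subspace W \<and> W \<subseteq> N \<and> openin (top_of_set U) N' \<and> 0 \<in> N' \<and> N' \<subseteq> W))"

definition closed_linear_variety :: "'v set \<Rightarrow> 'v set \<Rightarrow> bool" where
  "closed_linear_variety U A \<longleftrightarrow>
     (\<exists>v\<in>U. \<exists>W\<subseteq>U. subspace W \<and> closedin (top_of_set U) W \<and> A = (+) v ` W)"

text \<open>Intersecting with \<open>U\<close> makes the intersection of the empty collection equal to \<open>U\<close>.\<close>

definition linearly_compact :: "'v set \<Rightarrow> bool" where
  "linearly_compact U \<longleftrightarrow>
     linearly_topologized U \<and>
     (\<forall>\<A>. (\<forall>A\<in>\<A>. closed_linear_variety U A) \<and>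
          (\<forall>\<F>. finite \<F> \<and> \<F> \<subseteq> \<A> \<longrightarrow> U \<inter> \<Inter>\<F> \<noteq> {}) \<longrightarrow> U \<inter> \<Inter>\<A> \<noteq> {})"

text \<open>The quotient \<open>A/W\<close> of a subspace \<open>A\<close> by a subspace \<open>W\<close> of \<open>A\<close>. The summand \<open>w\<close> in the scalar
  multiplication is needed for the scalar \<open>0\<close>: the product has to be the coset \<open>W\<close>, not \<open>{0}\<close>.
  The fields \<open>mult\<close> and \<open>one\<close> of a module record have no meaning.\<close>

definition quotient_space :: "'v set \<Rightarrow> 'v set \<Rightarrow> ('k, 'v set) module" where
  "quotient_space A W =
     \<lparr>carrier = (\<lambda>v. (+) v ` W) ` A, mult = undefined, one = undefined,
      zero = W, add = (\<lambda>X Y. {x + y | x y. x \<in> X \<and> y \<in> Y}),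
      smult = (\<lambda>c X. {scale c x + w | x w. x \<in> X \<and> w \<in> W})\<rparr>"

text \<open>\<open>vectorspace.dim\<close> is meaningful for finite-dimensional spaces only.\<close>

definition quotient_dim :: "'v set \<Rightarrow> 'v set \<Rightarrow> enat" where
  "quotient_dim A W =
     (if vectorspace.fin_dim class_ring (quotient_space A W)
      then enat (vectorspace.dim class_ring (quotient_space A W)) else \<infinity>)"

end

locale locally_linearly_compact_space = topological_vector_space +
  assumes linearly_compact_nhds_basis:
    "open N \<Longrightarrow> 0 \<in> N \<Longrightarrow> \<exists>W. subspace W \<and> open W \<and> linearly_compact W \<and> W \<subseteq> N"

text \<open>\<open>C\<^sub>n(\<phi>, U)\<close>; only \<open>n \<ge> 1\<close> is relevant.\<close>

definition cotrajectory :: "nat \<Rightarrow> ('v \<Rightarrow> 'v) \<Rightarrow> 'v set \<Rightarrow> 'v set" where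
  "cotrajectory n \<phi> U = U \<inter> (\<Inter>k<n. (\<phi> ^^ k) -` U)"

definition (in topological_vector_space) codim_rate :: "('v \<Rightarrow> 'v) \<Rightarrow> 'v set \<Rightarrow> nat \<Rightarrow> ereal" where
  "codim_rate \<phi> U n = ereal_of_enat (quotient_dim U (cotrajectory n \<phi> U)) / ereal (real n)"

definition (in topological_vector_space) H_star :: "('v \<Rightarrow> 'v) \<Rightarrow> 'v set \<Rightarrow> ereal" where
  "H_star \<phi> U = lim (codim_rate \<phi> U)"

primrec U_seq :: "('v \<Rightarrow> 'v) \<Rightarrow> 'v set \<Rightarrow> nat \<Rightarrow> 'v set" where
  "U_seq \<phi> U 0 = U"
| "U_seq \<phi> U (Suc n) = U \<inter> \<phi> ` U_seq \<phi> U n"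

definition U_plus :: "('v \<Rightarrow> 'v) \<Rightarrow> 'v set \<Rightarrow> 'v set" where
  "U_plus \<phi> U = (\<Inter>n. U_seq \<phi> U n)"

end

theory Submission
  imports Defs
begin

text \<open>Since \<open>\<phi>\<^sup>n\<close> maps \<open>C\<^sub>n\<close> onto \<open>\<phi> U\<^bsub>n-1\<^esub>\<close> and \<open>C\<^bsub>n+1\<^esub>\<close> onto \<open>U \<inter> \<phi> U\<^bsub>n-1\<^esub> = U\<^sub>n\<close>,
  the increment of \<open>dim U/C\<^sub>n\<close> is \<open>dim C\<^sub>n/C\<^bsub>n+1\<^esub> = dim (\<phi> U\<^bsub>n-1\<^esub> + U)/U\<close>. These dimensions are finite
  and decreasing, so the subspaces \<open>\<phi> U\<^sub>n + U\<close> become stationary and \<open>H\<^sup>*\<close> is the dimension of the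
  stationary value modulo \<open>U\<close>. By linear compactness that value is \<open>\<phi> U\<^sub>+ + U\<close>, and
  \<open>U \<inter> \<phi> U\<^sub>+ = U\<^sub>+\<close>, whence \<open>(\<phi> U\<^sub>+ + U)/U\<close> is isomorphic to \<open>\<phi> U\<^sub>+/U\<^sub>+\<close>.\<close>

subsection \<open>Bases of quotient spaces\<close>

context topological_vector_space
begin

text \<open>For a subspace \<open>W\<close> this says that \<open>span B\<close> is a complement of
  \<open>W\<close> in \<open>A\<close>, so the cosets of \<open>B\<close> form a basis of
  \<open>A/W\<close>. Keeping the basis vectors in the ambient space leaves the linear algebra to
  \<open>independent\<close> and \<open>span\<close>; cosets enter only when
  \<open>quotient_dim\<close> is computed.\<close>

definition basis_modulo :: "'v set \<Rightarrow> 'v set \<Rightarrow> 'v set \<Rightarrow> bool" where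
  "basis_modulo A W B \<longleftrightarrow> independent B \<and> span B \<inter> W = {0} \<and> span (B \<union> W) = A"

lemma basis_modulo_subset: "basis_modulo A W B \<Longrightarrow> span B \<subseteq> A" "basis_modulo A W B \<Longrightarrow> W \<subseteq> A"
  unfolding basis_modulo_def by (auto intro: span_mono[THEN subsetD] span_base)

lemma basis_modulo_decompose:
  assumes "basis_modulo A W B" "subspace W" "a \<in> A"
  obtains x w where "x \<in> span B" "w \<in> W" "a = x + w"
proof -
  have "span W = W"
    using assms(2) span_eq_iff by blast
  show thesis
    using that assms(1,3) unfolding basis_modulo_def span_Un \<open>span W = W\<close> by blast
qed

text \<open>A common vector has one representation over \<open>B \<union> C\<close>, which agrees
  with those over \<open>B\<close> and over \<open>C\<close>. Its support lies in the empty set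
  \<open>B \<inter> C\<close>.\<close>

lemma span_Int_disjoint_eq_0:
  assumes "independent (B \<union> C)" "B \<inter> C = {}"
  shows "span B \<inter> span C = {0}"
proof -
  have "x = 0" if B: "x \<in> span B" and C: "x \<in> span C" for x
  proof -
    have rB: "representation (B \<union> C) x = representation B x"
      and rC: "representation (B \<union> C) x = representation C x"
      using representation_extend[OF assms(1) B] representation_extend[OF assms(1) C] by auto
    have "{b. representation B x b \<noteq> 0} = {}"
      using representation_ne_zero[of B x] representation_ne_zero[of C x] rB rC assms(2)
      by force
    moreover have "independent B"
      using assms(1) by (rule independent_mono) auto
    ultimately show "x = 0"
      using sum_nonzero_representation_eq[OF _ B] by simp
  qed
  then show ?thesis
    by (auto simp: span_zero)
qed

text \<open>Extend a basis \<open>C\<close> of \<open>W\<close> to a basis \<open>D\<close> of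
  \<open>A\<close> and take \<open>D - C\<close>. Infinite bases are allowed.\<close>

lemma basis_modulo_exists:
  assumes "subspace A" "subspace W" "W \<subseteq> A"
  obtains B where "basis_modulo A W B"
proof -
  obtain C where C: "C \<subseteq> W" "independent C" "W \<subseteq> span C"
    by (rule maximal_independent_subset_extend[OF empty_subsetI independent_empty])
  have "C \<subseteq> A"
    using C(1) assms(3) by simp
  then obtain D where D: "C \<subseteq> D" "D \<subseteq> A" "independent D" "A \<subseteq> span D"
    by (rule maximal_independent_subset_extend[OF _ C(2)])
  have spC: "span C = W"
    using C assms(2) by (intro subset_antisym span_minimal)
  have spW: "span W = W"
    using assms(2) span_eq_iff by blast
  have "span ((D - C) \<union> W) = span ((D - C) \<union> C)"
    unfolding span_Un[of "D - C"] spC spW ..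
  also have "\<dots> = span D"
    using D(1) by (simp add: Un_absorb2)
  also have "\<dots> = A"
    using D assms(1) by (intro subset_antisym span_minimal)
  finally have "span ((D - C) \<union> W) = A" .
  moreover have "span (D - C) \<inter> W = {0}"
    using span_Int_disjoint_eq_0[of "D - C" C] D spC by (simp add: Un_absorb2 Int_commute)
  moreover have "independent (D - C)"
    using D(3) by (rule independent_mono) auto
  ultimately show thesis
    using that[of "D - C"] unfolding basis_modulo_def by simp
qed

lemma independent_Un:
  assumes "independent B" "independent C" "span B \<inter> span C = {0}"
  shows "independent (B \<union> C)"
proof -
  \<comment> \<open>Only vectors of the first set are treated here; the claim is applied a second
    time with the two sets exchanged.\<close>
  have no: "False" if "independent B" "span B \<inter> span C = {0}" "a \<in> B"
    "a \<in> span (B \<union> C - {a})" for a B C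
  proof -
    have "a \<in> span ((B - {a}) \<union> C)"
      using that(4) by (rule span_mono[THEN subsetD, rotated]) auto
    then obtain x y where xy: "x \<in> span (B - {a})" "y \<in> span C" "a = x + y"
      unfolding span_Un by auto
    have "x \<in> span B"
      using xy(1) span_mono[of "B - {a}" B] by auto
    then have "y \<in> span B"
      using xy(3) span_diff[OF span_base[OF that(3)], of x] by simp
    then have "a = x"
      using xy that(2) by auto
    with xy(1) that(1,3) show False
      unfolding dependent_def by blast
  qed
  show ?thesis
    unfolding dependent_def
    using no[of B C] no[of C B] assms by (auto simp: Un_commute Int_commute)
qed

text \<open>Additivity of dimension along \<open>Z \<subseteq> W \<subseteq> A\<close> at the level
  of bases. Disjointness is recorded so that cardinalities add.\<close>

lemma basis_modulo_trans:
  assumes AW: "basis_modulo A W B" and WZ: "basis_modulo W Z C"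
  shows "basis_modulo A Z (B \<union> C)" "B \<inter> C = {}"
proof -
  have B: "independent B" "span B \<inter> W = {0}" "span (B \<union> W) = A"
    and C: "independent C" "span C \<inter> Z = {0}" "span (C \<union> Z) = W"
    using AW WZ unfolding basis_modulo_def by auto
  have spC: "span C \<subseteq> W"
    using basis_modulo_subset[OF WZ] by auto
  have "span B \<inter> span C = {0}"
    using B(2) spC by (auto simp: span_zero)
  then have "independent (B \<union> C)"
    using independent_Un B(1) C(1) by blast
  moreover have "span (B \<union> C) \<inter> Z = {0}"
  proof -
    have "v = 0" if v: "v \<in> span (B \<union> C)" and Z: "v \<in> Z" for v
    proof -
      obtain x y where xy: "x \<in> span B" "y \<in> span C" "v = x + y"
        using v unfolding span_Un by auto
      have "v \<in> W" "y \<in> W" "subspace W"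
        using basis_modulo_subset[OF WZ] Z xy(2) C(3) by auto
      then have "x \<in> W"
        using subspace_diff[of W v y] xy(3) by simp
      then have "x = 0"
        using B(2) xy(1) by auto
      then show ?thesis
        using xy C(2) Z by auto
    qed
    moreover have "0 \<in> Z"
      using C(2) by auto
    ultimately show ?thesis
      by (auto simp: span_zero)
  qed
  moreover have "span (B \<union> C \<union> Z) = A"
  proof -
    have spW: "span W = W"
      using C(3) span_span by metis
    have "span (B \<union> C \<union> Z) = {x + y |x y. x \<in> span B \<and> y \<in> W}"
      unfolding Un_assoc span_Un[of B] C(3) ..
    also have "\<dots> = span (B \<union> W)"
      unfolding span_Un[of B W] C(3) spW ..
    finally show ?thesis
      using B(3) by simp
  qed
  ultimately show "basis_modulo A Z (B \<union> C)"
    unfolding basis_modulo_def by blast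
  show "B \<inter> C = {}"
  proof (rule ccontr)
    assume "B \<inter> C \<noteq> {}"
    then obtain b where "b \<in> B" "b \<in> C" by blast
    then have "b = 0" "b \<in> B"
      using B(2) spC span_base by blast+
    then show False
      using B(1) dependent_zero by blast
  qed
qed

text \<open>The map \<open>f\<close> induces an isomorphism from the quotient of \<open>A\<close> by
  \<open>A \<inter> f -\<close> E\<open>onto the quotient of\<close>f \<open>A\<close> by
  \<open>E\<close>. Since \<open>0 \<in> E\<close>, the kernel of \<open>f\<close> meets
  \<open>span B\<close> only in 0, so \<open>f\<close> is injective on
  \<open>span B\<close>.\<close>

lemma basis_modulo_image:
  assumes f: "Vector_Spaces.linear scale scale f"
    and B: "basis_modulo A (A \<inter> f -` E) B" and A: "subspace A" and E: "subspace E" "E \<subseteq> f ` A"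
  shows "basis_modulo (f ` A) E (f ` B)" "inj_on f B"
proof -
  interpret f: Vector_Spaces.linear scale scale f by fact
  have B': "independent B" "span B \<inter> (A \<inter> f -` E) = {0}" "span (B \<union> (A \<inter> f -` E)) = A"
    using B unfolding basis_modulo_def by auto
  have spB: "span B \<subseteq> A"
    using basis_modulo_subset[OF B] by auto
  have ker: "x = 0" if "x \<in> span B" "f x \<in> E" for x
    using that B'(2) spB by blast
  have inj: "inj_on f (span B)"
  proof (rule inj_onI)
    fix x y assume "x \<in> span B" "y \<in> span B" "f x = f y"
    then have "x - y \<in> span B" "f (x - y) \<in> E"
      using subspace_0[OF E(1)] by (simp_all add: f.diff span_diff)
    then show "x = y"
      using ker[of "x - y"] by simp
  qed
  then show "inj_on f B"
    by (rule inj_on_subset) (simp add: span_superset)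
  have "independent (f ` B)"
    using f.independent_injective_image[OF B'(1) inj] .
  moreover have "span (f ` B) \<inter> E = {0}"
  proof (rule subset_antisym)
    show "span (f ` B) \<inter> E \<subseteq> {0}"
      unfolding f.span_image using ker f.zero by force
  qed (simp add: span_zero subspace_0[OF E(1)])
  moreover have "span (f ` B \<union> E) = f ` A"
  proof -
    have "f ` B \<union> E = f ` (B \<union> (A \<inter> f -` E))"
      using E(2) by auto
    then show ?thesis
      using f.span_image[of "B \<union> (A \<inter> f -` E)"] B'(3) by simp
  qed
  ultimately show "basis_modulo (f ` A) E (f ` B)"
    unfolding basis_modulo_def by blast
qed

text \<open>The second isomorphism theorem, with the same \<open>B\<close> on both sides;
  \<open>span (A \<union> U)\<close> plays the part of \<open>A + U\<close>.\<close>

lemma basis_modulo_sum: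
  assumes B: "basis_modulo A (A \<inter> U) B" and U: "subspace U"
  shows "basis_modulo (span (A \<union> U)) U B"
proof -
  have B': "independent B" "span B \<inter> (A \<inter> U) = {0}" "span (B \<union> (A \<inter> U)) = A"
    using B unfolding basis_modulo_def by auto
  have "span (B \<union> U) = span (A \<union> U)"
  proof (rule subset_antisym)
    show "span (A \<union> U) \<subseteq> span (B \<union> U)"
      using span_mono[of "B \<union> (A \<inter> U)" "B \<union> U"] B'(3)
      by (intro span_minimal) (auto intro: span_base)
    show "span (B \<union> U) \<subseteq> span (A \<union> U)"
      using basis_modulo_subset[OF B] span_superset[of B] by (intro span_mono) auto
  qed
  moreover have "span B \<inter> U = {0}"
    using B'(2) basis_modulo_subset(1)[OF B] by (simp add: Int_assoc[symmetric] Int_absorb2)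
  ultimately show ?thesis
    unfolding basis_modulo_def using B'(1) by simp
qed

section \<open>Cosets and the dimension of the quotient record\<close>

definition coset :: "'v set \<Rightarrow> 'v \<Rightarrow> 'v set" where
  "coset W v = (+) v ` W"

lemma coset_eq_iff:
  assumes W: "subspace W"
  shows "coset W x = coset W y \<longleftrightarrow> x - y \<in> W"
  unfolding coset_def
proof
  assume "(+) x ` W = (+) y ` W"
  moreover have "x \<in> (+) x ` W"
    using subspace_0[OF W] by (auto intro: image_eqI[of _ _ 0])
  ultimately show "x - y \<in> W"
    by auto
next
  have sub: "(+) x ` W \<subseteq> (+) y ` W" if "x - y \<in> W" for x y
  proof
    fix z assume "z \<in> (+) x ` W"
    then obtain w where "w \<in> W" "z = x + w"
      by auto
    then have "z = y + ((x - y) + w)" "(x - y) + w \<in> W"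
      using that subspace_add[OF W] by auto
    then show "z \<in> (+) y ` W"
      by blast
  qed
  assume "x - y \<in> W"
  moreover from this have "y - x \<in> W"
    using subspace_neg[OF W] by fastforce
  ultimately show "(+) x ` W = (+) y ` W"
    using sub by (intro subset_antisym)
qed

lemma coset_add:
  assumes W: "subspace W"
  shows "{a + b | a b. a \<in> coset W x \<and> b \<in> coset W y} = coset W (x + y)"
  unfolding coset_def
proof (intro subset_antisym subsetI)
  fix z assume "z \<in> {a + b | a b. a \<in> (+) x ` W \<and> b \<in> (+) y ` W}"
  then obtain u v where "u \<in> W" "v \<in> W" "z = (x + u) + (y + v)"
    by auto
  then have "z = (x + y) + (u + v)" "u + v \<in> W"
    using subspace_add[OF W] by auto
  then show "z \<in> (+) (x + y) ` W"
    by blast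
next
  fix z assume "z \<in> (+) (x + y) ` W"
  then obtain w where "w \<in> W" "z = (x + w) + (y + 0)"
    by (auto simp: algebra_simps)
  then show "z \<in> {a + b | a b. a \<in> (+) x ` W \<and> b \<in> (+) y ` W}"
    using subspace_0[OF W] by blast
qed

lemma coset_scale:
  assumes W: "subspace W"
  shows "{scale c a + w | a w. a \<in> coset W x \<and> w \<in> W} = coset W (scale c x)"
  unfolding coset_def
proof (intro subset_antisym subsetI)
  fix z assume "z \<in> {scale c a + w | a w. a \<in> (+) x ` W \<and> w \<in> W}"
  then obtain u v where "u \<in> W" "v \<in> W" "z = scale c (x + u) + v"
    by auto
  then have "z = scale c x + (scale c u + v)" "scale c u + v \<in> W"
    using subspace_add[OF W] subspace_scale[OF W] by (auto simp: scale_right_distrib)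
  then show "z \<in> (+) (scale c x) ` W"
    by blast
next
  fix z assume "z \<in> (+) (scale c x) ` W"
  then obtain w where "w \<in> W" "z = scale c (x + 0) + w"
    by auto
  then show "z \<in> {scale c a + w | a w. a \<in> (+) x ` W \<and> w \<in> W}"
    using subspace_0[OF W] by blast
qed

lemma carrier_quotient_space: "carrier (quotient_space A W) = coset W ` A"
  unfolding quotient_space_def by (simp add: coset_def image_def)

lemma zero_quotient_space: "\<zero>\<^bsub>quotient_space A W\<^esub> = coset W 0"
  unfolding quotient_space_def coset_def by simp

lemma add_quotient_space:
  "subspace W \<Longrightarrow> coset W x \<oplus>\<^bsub>quotient_space A W\<^esub> coset W y = coset W (x + y)"
  unfolding quotient_space_def by (simp add: coset_add)

lemma smult_quotient_space:
  "subspace W \<Longrightarrow> c \<odot>\<^bsub>quotient_space A W\<^esub> coset W x = coset W (scale c x)"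
  unfolding quotient_space_def by (simp add: coset_scale)

lemmas quotient_space_simps =
  carrier_quotient_space zero_quotient_space add_quotient_space smult_quotient_space

lemma vectorspace_quotient_space:
  assumes A: "subspace A" and W: "subspace W"
  shows "vectorspace class_ring (quotient_space A W)"
proof -
  have "Module.module class_ring (quotient_space A W)"
  proof (rule module_criteria)
    show "\<zero>\<^bsub>quotient_space A W\<^esub> \<in> carrier (quotient_space A W)"
      unfolding quotient_space_simps using subspace_0[OF A] by blast
    show "\<forall>v\<in>carrier (quotient_space A W). \<exists>u\<in>carrier (quotient_space A W).
        v \<oplus>\<^bsub>quotient_space A W\<^esub> u = \<zero>\<^bsub>quotient_space A W\<^esub>"
    proof
      fix v assume "v \<in> carrier (quotient_space A W)"
      then obtain x where x: "x \<in> A" "v = coset W x"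
        unfolding quotient_space_simps by auto
      show "\<exists>u\<in>carrier (quotient_space A W). v \<oplus>\<^bsub>quotient_space A W\<^esub> u = \<zero>\<^bsub>quotient_space A W\<^esub>"
      proof (rule bexI)
        show "v \<oplus>\<^bsub>quotient_space A W\<^esub> coset W (- x) = \<zero>\<^bsub>quotient_space A W\<^esub>"
          by (simp only: x(2) quotient_space_simps W add.right_inverse)
        show "coset W (- x) \<in> carrier (quotient_space A W)"
          unfolding quotient_space_simps using subspace_neg[OF A x(1)] by blast
      qed
    qed
  qed (auto simp: quotient_space_simps W scale_left_distrib scale_right_distrib
      subspace_add[OF A] subspace_scale[OF A] add_ac class_cring.is_cring)
  then show ?thesis
    by (intro vectorspace.intro class_field)
qed

lemma lincomb_quotient_space:
  assumes A: "subspace A" and W: "subspace W"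
    and F: "finite F" "F \<subseteq> A" "inj_on (coset W) F"
  shows "LinearCombinations.module.lincomb (quotient_space A W) a (coset W ` F)
    = coset W (\<Sum>b\<in>F. scale (a (coset W b)) b)"
proof -
  interpret Q: vectorspace class_ring "quotient_space A W"
    using vectorspace_quotient_space[OF A W] .
  show ?thesis
    using F
  proof (induction F rule: finite_induct)
    case empty
    then show ?case
      by (simp add: Q.lincomb_def zero_quotient_space)
  next
    case (insert b F)
    have "Q.lincomb a (coset W ` F \<union> {coset W b})
        = a (coset W b) \<odot>\<^bsub>quotient_space A W\<^esub> coset W b
          \<oplus>\<^bsub>quotient_space A W\<^esub> Q.lincomb a (coset W ` F)"
      using insert.hyps insert.prems
      by (intro Q.lincomb_insert) (auto simp: carrier_quotient_space inj_on_def)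
    then show ?case
      using insert W by (simp add: add_quotient_space smult_quotient_space)
  qed
qed

lemma basis_modulo_inj_on_coset:
  assumes B: "basis_modulo A W B" and W: "subspace W"
  shows "inj_on (coset W) B"
proof (rule inj_onI)
  fix x y assume "x \<in> B" "y \<in> B" "coset W x = coset W y"
  then have "x - y \<in> span B \<inter> W"
    using coset_eq_iff[OF W] by (simp add: span_diff span_base)
  then show "x = y"
    using B unfolding basis_modulo_def by simp
qed

text \<open>A vanishing combination of cosets lifts to a vector of \<open>span B \<inter> W\<close>,
  hence to 0. Stating it for finite subsets \<open>F\<close> also covers infinite
  \<open>B\<close>.\<close>

lemma basis_modulo_lin_indpt:
  assumes A: "subspace A" and W: "subspace W" and B: "basis_modulo A W B" and F: "finite F" "F \<subseteq> B"
  shows "\<not> LinearCombinations.module.lin_dep class_ring (quotient_space A W) (coset W ` F)"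
proof -
  interpret Q: vectorspace class_ring "quotient_space A W"
    using vectorspace_quotient_space[OF A W] .
  have FA: "F \<subseteq> A"
    using F(2) basis_modulo_subset(1)[OF B] span_superset[of B] by auto
  have inj: "inj_on (coset W) F"
    using basis_modulo_inj_on_coset[OF B W] F(2) by (rule inj_on_subset)
  have indep: "independent F"
    using B independent_mono[OF _ F(2)] unfolding basis_modulo_def by simp
  show ?thesis
  proof (rule Q.finite_lin_indpt2)
    fix a assume "Q.lincomb a (coset W ` F) = \<zero>\<^bsub>quotient_space A W\<^esub>"
    then have "(\<Sum>b\<in>F. scale (a (coset W b)) b) \<in> W"
      unfolding lincomb_quotient_space[OF A W F(1) FA inj] zero_quotient_space coset_eq_iff[OF W]
      by simp
    moreover have "(\<Sum>b\<in>F. scale (a (coset W b)) b) \<in> span B"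
      using F(2) by (intro span_sum span_scale span_base) auto
    ultimately have "(\<Sum>b\<in>F. scale (a (coset W b)) b) = 0"
      using B unfolding basis_modulo_def by blast
    then have "\<forall>b\<in>F. a (coset W b) = 0"
      using independentD[OF indep F(1) order_refl, of "\<lambda>b. a (coset W b)"] by blast
    then show "\<forall>v\<in>coset W ` F. a v = \<zero>\<^bsub>class_ring\<^esub>"
      by simp
  qed (use F(1) FA in \<open>auto simp: carrier_quotient_space\<close>)
qed

lemma basis_modulo_basis:
  assumes A: "subspace A" and W: "subspace W" and B: "basis_modulo A W B" "finite B"
  shows "vectorspace.basis class_ring (quotient_space A W) (coset W ` B)"
proof -
  interpret Q: vectorspace class_ring "quotient_space A W"
    using vectorspace_quotient_space[OF A W] .
  have BA: "B \<subseteq> A"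
    using basis_modulo_subset(1)[OF B(1)] span_superset[of B] by auto
  have car: "coset W ` B \<subseteq> carrier (quotient_space A W)"
    using BA by (auto simp: carrier_quotient_space)
  note inj = basis_modulo_inj_on_coset[OF B(1) W]
  have "carrier (quotient_space A W) \<subseteq> Q.span (coset W ` B)"
  proof
    fix X assume "X \<in> carrier (quotient_space A W)"
    then obtain v where v: "v \<in> A" "X = coset W v"
      by (auto simp: carrier_quotient_space)
    obtain x w where x: "x \<in> span B" "w \<in> W" "v = x + w"
      using basis_modulo_decompose[OF B(1) W v(1)] .
    obtain u where u: "x = (\<Sum>b\<in>B. scale (u b) b)"
      using x(1) unfolding span_finite[OF B(2)] by auto
    \<comment> \<open>The coefficients \<open>u\<close> are indexed by vectors, those of
      \<open>Q.lincomb\<close> by cosets; \<open>a\<close> transports them along the inverse of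
      \<open>coset W\<close> on \<open>B\<close>.\<close>
    define a where "a = u \<circ> the_inv_into B (coset W)"
    have a: "a (coset W b) = u b" if "b \<in> B" for b
      using the_inv_into_f_f[OF inj that] unfolding a_def by simp
    have "X = coset W x"
      using x v(2) coset_eq_iff[OF W] by simp
    also have "\<dots> = Q.lincomb a (coset W ` B)"
      unfolding lincomb_quotient_space[OF A W B(2) BA inj] u using a by simp
    finally show "X \<in> Q.span (coset W ` B)"
      unfolding Q.span_def using B(2) by auto
  qed
  then have "Q.gen_set (coset W ` B)"
    using Q.span_is_subset2[OF car] by blast
  then show ?thesis
    unfolding Q.basis_def using car basis_modulo_lin_indpt[OF A W B(1,2) order_refl] by blast
qed

text \<open>The bridge from the record to \<open>basis_modulo\<close>: all later facts about
  \<open>quotient_dim\<close> are obtained by counting such a \<open>B\<close>.\<close>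

lemma quotient_dim_basis_modulo:
  assumes A: "subspace A" and W: "subspace W" and B: "basis_modulo A W B"
  shows "quotient_dim A W = (if finite B then enat (card B) else \<infinity>)"
proof -
  interpret Q: vectorspace class_ring "quotient_space A W"
    using vectorspace_quotient_space[OF A W] .
  note inj = basis_modulo_inj_on_coset[OF B W]
  show ?thesis
  proof (cases "finite B")
    case True
    have "Q.basis (coset W ` B)"
      using basis_modulo_basis[OF A W B True] .
    then have "Q.fin_dim" "Q.dim = card B"
      using Q.dim_basis[of "coset W ` B"] True card_image[OF inj]
      unfolding Q.fin_dim_def Q.basis_def by auto
    then show ?thesis
      using True by (simp add: quotient_dim_def)
  next
    case False
    have "\<not> Q.fin_dim"
    proof
      assume fd: "Q.fin_dim"
      \<comment> \<open>One vector more than the supposed dimension: their cosets are independent,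
        which is impossible.\<close>
      obtain F where F: "F \<subseteq> B" "finite F" "card F = Suc Q.dim"
        using infinite_arbitrarily_large[OF False] by blast
      have "card (coset W ` F) \<le> Q.dim"
      proof (rule Q.li_le_dim(2)[OF fd])
        show "coset W ` F \<subseteq> carrier (quotient_space A W)"
          using F(1) basis_modulo_subset(1)[OF B] span_superset[of B]
          by (auto simp: carrier_quotient_space)
      qed (rule basis_modulo_lin_indpt[OF A W B F(2,1)])
      then show False
        using card_image[OF inj_on_subset[OF inj F(1)]] F(3) by simp
    qed
    then show ?thesis
      using False by (simp add: quotient_dim_def)
  qed
qed

section \<open>Additivity and isomorphism theorems for \<open>quotient_dim\<close>\<close>

lemma quotient_dim_trans:
  assumes "subspace A" "subspace W" "subspace Z" "W \<subseteq> A" "Z \<subseteq> W"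
  shows "quotient_dim A Z = quotient_dim A W + quotient_dim W Z"
proof -
  obtain B where B: "basis_modulo A W B"
    using basis_modulo_exists assms(1,2,4) .
  obtain C where C: "basis_modulo W Z C"
    using basis_modulo_exists assms(2,3,5) .
  note BC = basis_modulo_trans[OF B C]
  show ?thesis
    using quotient_dim_basis_modulo[OF assms(1,2) B] quotient_dim_basis_modulo[OF assms(2,3) C]
      quotient_dim_basis_modulo[OF assms(1,3) BC(1)] card_Un_disjoint[OF _ _ BC(2)]
    by simp
qed

lemma quotient_dim_image:
  assumes f: "Vector_Spaces.linear scale scale f"
    and A: "subspace A" and E: "subspace E" "E \<subseteq> f ` A"
  shows "quotient_dim (f ` A) E = quotient_dim A (A \<inter> f -` E)"
proof -
  interpret f: Vector_Spaces.linear scale scale f by fact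
  have AE: "subspace (A \<inter> f -` E)"
    using A E(1) by (simp add: subspace_inter f.subspace_vimage)
  obtain B where B: "basis_modulo A (A \<inter> f -` E) B"
    using basis_modulo_exists A AE Int_lower1 .
  note fB = basis_modulo_image[OF f B A E]
  show ?thesis
    using quotient_dim_basis_modulo[OF A AE B] card_image[OF fB(2)] finite_image_iff[OF fB(2)]
      quotient_dim_basis_modulo[OF f.subspace_image[OF A] E(1) fB(1)]
    by simp
qed

lemma quotient_dim_sum:
  assumes A: "subspace A" and U: "subspace U"
  shows "quotient_dim (span (A \<union> U)) U = quotient_dim A (A \<inter> U)"
proof -
  have AU: "subspace (A \<inter> U)"
    using A U by (rule subspace_inter)
  obtain B where B: "basis_modulo A (A \<inter> U) B"
    using basis_modulo_exists A AU Int_lower1 .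
  show ?thesis
    using quotient_dim_basis_modulo[OF A AU B]
      quotient_dim_basis_modulo[OF subspace_span U basis_modulo_sum[OF B U]]
    by simp
qed

lemma quotient_dim_eq_0:
  assumes A: "subspace A" and W: "subspace W" "W \<subseteq> A" and 0: "quotient_dim A W = 0"
  shows "A = W"
proof -
  obtain B where B: "basis_modulo A W B"
    using basis_modulo_exists A W .
  then have "finite B" "card B = 0"
    using quotient_dim_basis_modulo[OF A W(1) B] 0 by (auto simp: zero_enat_def split: if_splits)
  then have "B = {}"
    by simp
  have "span W = W"
    using W(1) span_eq_iff by metis
  then show ?thesis
    using B unfolding basis_modulo_def \<open>B = {}\<close> Un_empty_left by metis
qed

subsection \<open>Linear compactness\<close>

text \<open>The complement of \<open>S\<close> is the union of the cosets \<open>x + S\<close> with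
  \<open>x\<close> outside \<open>S\<close>, and these are open.\<close>

lemma open_subspace_closed:
  assumes "subspace S" "open S"
  shows "closed S"
proof -
  have "- S = (\<Union>x\<in>- S. (\<lambda>y. y - x) -` S)"
  proof (intro subset_antisym subsetI)
    fix y assume "y \<in> - S"
    then show "y \<in> (\<Union>x\<in>- S. (\<lambda>y. y - x) -` S)"
      using subspace_0[OF assms(1)] by (intro UN_I[of y]) auto
  next
    fix y assume "y \<in> (\<Union>x\<in>- S. (\<lambda>y. y - x) -` S)"
    then obtain x where "x \<notin> S" "y - x \<in> S"
      by auto
    then show "y \<in> - S"
      using subspace_diff[OF assms(1), of y "y - x"] by auto
  qed
  moreover have "open (\<Union>x\<in>- S. (\<lambda>y. y - x) -` S)"
    using assms(2) by (intro open_UN ballI open_vimage continuous_intros)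
  ultimately show ?thesis
    unfolding closed_def by simp
qed

lemma open_subspace_superset:
  assumes "subspace S" "subspace T" "open S" "S \<subseteq> T"
  shows "open T"
proof -
  have "T = (\<Union>x\<in>T. (\<lambda>y. y - x) -` S)"
  proof (intro subset_antisym subsetI)
    fix y assume "y \<in> T"
    then show "y \<in> (\<Union>x\<in>T. (\<lambda>y. y - x) -` S)"
      using subspace_0[OF assms(1)] by (intro UN_I[of y]) auto
  next
    fix y assume "y \<in> (\<Union>x\<in>T. (\<lambda>y. y - x) -` S)"
    then obtain x where "x \<in> T" "y - x \<in> T"
      using assms(4) by auto
    then show "y \<in> T"
      using subspace_add[OF assms(2), of x "y - x"] by simp
  qed
  moreover have "open (\<Union>x\<in>T. (\<lambda>y. y - x) -` S)"
    using assms(3) by (intro open_UN ballI open_vimage continuous_intros)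
  ultimately show ?thesis
    by simp
qed

lemma closed_linear_variety_preimage:
  assumes f: "Vector_Spaces.linear scale scale f" "continuous_on UNIV f"
    and C: "subspace C" "closed C" "C \<subseteq> U" and W: "subspace W" "closed W"
    and v: "v \<in> C" "f v - x \<in> W"
  shows "closed_linear_variety U {z \<in> C. f z - x \<in> W}"
proof -
  interpret f: Vector_Spaces.linear scale scale f by fact
  have "closed (C \<inter> f -` W)"
    using C(2) closed_vimage[OF W(2) f(2)] by (rule closed_Int)
  then have "closedin (top_of_set U) (C \<inter> f -` W)"
    using C(3) by (intro closed_subset) auto
  moreover have "subspace (C \<inter> f -` W)"
    using C(1) W(1) by (simp add: subspace_inter f.subspace_vimage)
  moreover have "{z \<in> C. f z - x \<in> W} = (+) v ` (C \<inter> f -` W)"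
  proof (intro subset_antisym subsetI)
    fix z assume z: "z \<in> {z \<in> C. f z - x \<in> W}"
    then have "z - v \<in> C"
      using v(1) subspace_diff[OF C(1)] by simp
    moreover have "f (z - v) \<in> W"
      using subspace_diff[OF W(1), of "f z - x" "f v - x"] z v(2) by (simp add: f.diff)
    ultimately show "z \<in> (+) v ` (C \<inter> f -` W)"
      by (intro image_eqI[of _ _ "z - v"]) auto
  next
    fix z assume "z \<in> (+) v ` (C \<inter> f -` W)"
    then obtain u where u: "u \<in> C" "f u \<in> W" "z = v + u"
      by auto
    then show "z \<in> {z \<in> C. f z - x \<in> W}"
      using subspace_add[OF C(1) v(1)] subspace_add[OF W(1) v(2), of "f u"]
      by (simp add: f.add algebra_simps)
  qed
  ultimately show ?thesis
    unfolding closed_linear_variety_def using C(3) v(1) by blast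
qed

lemma linearly_compact_subspace: "linearly_compact U \<Longrightarrow> subspace U"
  unfolding linearly_compact_def linearly_topologized_def by blast

lemma linearly_compactD:
  assumes "linearly_compact U" "\<And>A. A \<in> \<A> \<Longrightarrow> closed_linear_variety U A"
    and "\<And>\<F>. finite \<F> \<Longrightarrow> \<F> \<subseteq> \<A> \<Longrightarrow> U \<inter> \<Inter>\<F> \<noteq> {}"
  shows "U \<inter> \<Inter>\<A> \<noteq> {}"
  using assms(1)[unfolded linearly_compact_def, THEN conjunct2, rule_format, of \<A>] assms(2,3)
  by simp

text \<open>In a downward directed family each finite intersection contains a member, so nonempty
  members give the finite intersection property.\<close>

lemma linearly_compact_directed:
  assumes U: "linearly_compact U"
    and ne: "\<A> \<noteq> {}" "{} \<notin> \<A>" and cl: "\<And>A. A \<in> \<A> \<Longrightarrow> closed_linear_variety U A"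
    and dir: "\<And>A B. A \<in> \<A> \<Longrightarrow> B \<in> \<A> \<Longrightarrow> \<exists>C\<in>\<A>. C \<subseteq> A \<inter> B"
  shows "\<Inter>\<A> \<noteq> {}"
proof -
  have sub: "A \<subseteq> U" if "A \<in> \<A>" for A
    using cl[OF that] subspace_add[OF linearly_compact_subspace[OF U]]
    unfolding closed_linear_variety_def by blast
  have fip: "U \<inter> \<Inter>\<F> \<noteq> {}" if "finite \<F>" "\<F> \<subseteq> \<A>" for \<F>
  proof -
    have "\<exists>C\<in>\<A>. C \<subseteq> \<Inter>\<F>"
      using that
    proof (induction \<F> rule: finite_induct)
      case empty
      then show ?case using ne(1) by auto
    next
      case (insert A \<F>)
      then obtain C where "C \<in> \<A>" "C \<subseteq> \<Inter>\<F>" "A \<in> \<A>"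
        by auto
      then show ?case
        using dir[of A C] by auto
    qed
    then obtain C where "C \<in> \<A>" "C \<subseteq> \<Inter>\<F>"
      by auto
    moreover have "C \<noteq> {}"
      using ne(2) \<open>C \<in> \<A>\<close> by auto
    ultimately show ?thesis
      using sub by blast
  qed
  have "U \<inter> \<Inter>\<A> \<noteq> {}"
    by (rule linearly_compactD[OF U cl fip])
  then show ?thesis
    by auto
qed

text \<open>Lets the image under \<open>f\<close>, taken modulo \<open>W\<close>, commute with a
  decreasing intersection: the solution sets in the \<open>K n\<close> form a chain of closed linear
  varieties.\<close>

lemma linearly_compact_decreasing_preimage:
  assumes U: "linearly_compact U" and f: "Vector_Spaces.linear scale scale f" "continuous_on UNIV f"
    and K: "\<And>n. subspace (K n)" "\<And>n. closed (K n)" "\<And>n. K n \<subseteq> U" "decseq K"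
    and W: "subspace W" "closed W" and ex: "\<And>n. \<exists>z\<in>K n. f z - x \<in> W"
  shows "\<exists>z\<in>\<Inter>n. K n. f z - x \<in> W"
proof -
  have "(\<Inter>n. {z \<in> K n. f z - x \<in> W}) \<noteq> {}"
  proof (rule linearly_compact_directed[OF U])
    show "{} \<notin> range (\<lambda>n. {z \<in> K n. f z - x \<in> W})"
      using ex by fastforce
  next
    fix A assume "A \<in> range (\<lambda>n. {z \<in> K n. f z - x \<in> W})"
    then obtain n where "A = {z \<in> K n. f z - x \<in> W}"
      by auto
    then show "closed_linear_variety U A"
      using closed_linear_variety_preimage[OF f K(1-3) W] ex[of n] by auto
  next
    fix A B assume "A \<in> range (\<lambda>n. {z \<in> K n. f z - x \<in> W})" "B \<in> range (\<lambda>n. {z \<in> K n. f z - x \<in> W})"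
    then obtain m n where "A = {z \<in> K m. f z - x \<in> W}" "B = {z \<in> K n. f z - x \<in> W}"
      by auto
    then show "\<exists>C\<in>range (\<lambda>n. {z \<in> K n. f z - x \<in> W}). C \<subseteq> A \<inter> B"
      using decseqD[OF K(4), of m "max m n"] decseqD[OF K(4), of n "max m n"]
      by (intro bexI[of _ "{z \<in> K (max m n). f z - x \<in> W}"]) auto
  qed simp
  then show ?thesis
    by auto
qed

text \<open>If a basis \<open>B\<close> modulo \<open>C\<close> were infinite, prescribing the value
  1 for every coordinate would be solvable for any finite set of coordinates. By linear compactness
  it would be solvable for all of them, although a vector has only finitely many nonzero
  coordinates.\<close>

lemma linearly_compact_open_finite_codim:
  assumes U: "linearly_compact U" and C: "subspace C" "open C" "C \<subseteq> U"
  shows "quotient_dim U C \<noteq> \<infinity>"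
proof -
  note sU = linearly_compact_subspace[OF U]
  obtain B where B: "basis_modulo U C B"
    using basis_modulo_exists sU C(1,3) .
  have BU: "B \<subseteq> U"
    using basis_modulo_subset(1)[OF B] span_superset[of B] by auto
  \<comment> \<open>For \<open>b \<in> B\<close> this is the hyperplane of \<open>U\<close> on which
    the coordinate at \<open>b\<close> vanishes. It contains the open \<open>C\<close>, hence is
    open and closed; \<open>b + S b\<close> is the variety where that coordinate is 1.\<close>
  define S where "S b = span (B - {b} \<union> C)" for b
  have sS: "subspace (S b)" for b
    unfolding S_def by simp
  have CS: "C \<subseteq> S b" for b
    unfolding S_def using span_superset[of "B - {b} \<union> C"] by auto
  have BS: "c \<in> S b" if "c \<in> B" "c \<noteq> b" for b c
    unfolding S_def using that by (intro span_base) auto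
  have SU: "S b \<subseteq> U" for b
    unfolding S_def using BU C(3) by (intro span_minimal sU) auto
  have "finite B"
  proof (rule ccontr)
    assume inf: "infinite B"
    have cl: "closed_linear_variety U ((+) b ` S b)" if "b \<in> B" for b
    proof -
      have "closedin (top_of_set U) (S b)"
        using open_subspace_closed[OF sS open_subspace_superset[OF C(1) sS C(2) CS]] SU
        by (rule closed_subset[rotated])
      then show ?thesis
        unfolding closed_linear_variety_def using SU sS BU that by blast
    qed
    have fip: "U \<inter> \<Inter>\<F> \<noteq> {}" if fin: "finite \<F>" "\<F> \<subseteq> (\<lambda>b. (+) b ` S b) ` B" for \<F>
    proof -
      obtain F where F: "F \<subseteq> B" "finite F" "\<F> = (\<lambda>b. (+) b ` S b) ` F"
        using finite_subset_image[OF fin] by auto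
      \<comment> \<open>The sum of the vectors of \<open>F\<close> has coordinate 1 at each of
        them.\<close>
      have "\<Sum>F \<in> (+) b ` S b" if "b \<in> F" for b
      proof (rule image_eqI)
        show "\<Sum>F = b + \<Sum>(F - {b})"
          using sum.remove[OF F(2) that, of "\<lambda>x. x"] .
        show "\<Sum>(F - {b}) \<in> S b"
          using BS F(1) by (intro subspace_sum[OF sS]) auto
      qed
      moreover have "\<Sum>F \<in> U"
        using F(1) BU by (intro subspace_sum[OF sU]) auto
      ultimately show ?thesis
        unfolding F(3) by auto
    qed
    have "U \<inter> (\<Inter>b\<in>B. (+) b ` S b) \<noteq> {}"
      by (rule linearly_compactD[OF U _ fip]) (use cl in auto)
    then obtain x where x: "x \<in> U" "\<And>b. b \<in> B \<Longrightarrow> x \<in> (+) b ` S b"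
      by auto
    obtain s c where s: "s \<in> span B" "c \<in> C" "x = s + c"
      using basis_modulo_decompose[OF B C(1) x(1)] .
    obtain F r where F: "finite F" "F \<subseteq> B" and s_sum: "s = (\<Sum>b\<in>F. scale (r b) b)"
      using s(1) unfolding span_explicit by auto
    have sF: "s \<in> span F"
      unfolding s_sum by (intro span_sum span_scale span_base)
    \<comment> \<open>Outside the finite support of \<open>s\<close> the coordinate of
      \<open>x\<close> is 0, whereas \<open>x \<in> b + S b\<close> demands 1. The rest turns this
      clash into a dependence of \<open>b\<close> on \<open>B - {b}\<close>.\<close>
    obtain b where b: "b \<in> B" "b \<notin> F"
      using inf finite_subset[OF _ F(1), of B] by auto
    obtain t where t: "t \<in> S b" "x = b + t"
      using x(2)[OF b(1)] by auto
    have "s \<in> S b"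
    proof -
      have "span F \<subseteq> S b"
        by (intro span_minimal sS subsetI BS) (use b F(2) in auto)
      then show ?thesis
        using sF by auto
    qed
    then have "s + c - t \<in> S b"
      using CS s(2) t(1) by (intro subspace_diff[OF sS] subspace_add[OF sS]) auto
    then have "b \<in> span (B - {b} \<union> C)"
      using t(2) s(3) unfolding S_def by simp
    then obtain y w where y: "y \<in> span (B - {b})" "w \<in> span C" "b = y + w"
      unfolding span_Un by auto
    have "w \<in> C"
      using y(2) span_eq_iff[THEN iffD2, OF C(1)] by (simp only:)
    moreover have "w \<in> span B"
    proof -
      have "y \<in> span B"
        using y(1) span_mono[of "B - {b}" B] by auto
      then have "b - y \<in> span B"
        using span_diff[OF span_base[OF b(1)]] by simp
      then show ?thesis
        using y(3) by simp
    qed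
    ultimately have "w = 0"
      using B unfolding basis_modulo_def by auto
    then have "b \<in> span (B - {b})"
      using y by simp
    then have "dependent B"
      unfolding dependent_def using b(1) by auto
    then show False
      using B unfolding basis_modulo_def by simp
  qed
  then show ?thesis
    using quotient_dim_basis_modulo[OF sU C(1) B] by simp
qed

end

section \<open>Separation by open subspaces and closedness of images\<close>

context locally_linearly_compact_space
begin

text \<open>The Hausdorff property is given inside \<open>U\<close>, so a point of \<open>U\<close>
  is separated from 0 there and the neighborhood is shrunk to an open subspace. For a point outside,
  \<open>U\<close> itself serves.\<close>

lemma separating_open_subspace:
  assumes U: "linearly_compact U" "open U" and x: "x \<noteq> 0"
  obtains W where "subspace W" "open W" "x \<notin> W"
proof (cases "x \<in> U")
  case True
  have "0 \<in> U"
    using subspace_0[OF linearly_compact_subspace[OF U(1)]] .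
  have "Hausdorff_space (top_of_set U)"
    using U(1) unfolding linearly_compact_def linearly_topologized_def by blast
  then obtain N M where NM: "openin (top_of_set U) N" "openin (top_of_set U) M"
      "0 \<in> N" "x \<in> M" "disjnt N M"
    using True \<open>0 \<in> U\<close> x unfolding Hausdorff_space_def by (metis topspace_euclidean_subtopology)
  have "open N"
    using NM(1) U(2) by (simp add: openin_open_eq)
  then obtain W where "subspace W" "open W" "W \<subseteq> N"
    using linearly_compact_nhds_basis NM(3) by blast
  then show thesis
    using that NM(4,5) unfolding disjnt_def by blast
next
  case False
  then show thesis
    using that U linearly_compact_subspace by blast
qed

text \<open>For \<open>x\<close> in the closure, the equation \<open>f z = x\<close> is solvable in
  \<open>C\<close> modulo every open subspace \<open>W\<close>. Linear compactness gives one
  \<open>z\<close> for all \<open>W\<close>, and separation makes the solution exact.\<close>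

lemma closed_image_subspace:
  assumes U: "linearly_compact U" "open U"
    and f: "Vector_Spaces.linear scale scale f" "continuous_on UNIV f"
    and C: "subspace C" "closed C" "C \<subseteq> U"
  shows "closed (f ` C)"
proof -
  have "x \<in> f ` C" if x: "x \<in> closure (f ` C)" for x
  proof -
    define \<W> where "\<W> = {W. subspace W \<and> open W}"
    define P where "P W = {z \<in> C. f z - x \<in> W}" for W
    have ne: "\<exists>v. v \<in> P W" if W: "W \<in> \<W>" for W
    proof -
      have "open ((\<lambda>y. y - x) -` W)"
        using W unfolding \<W>_def by (intro open_vimage continuous_intros) auto
      moreover have "x \<in> (\<lambda>y. y - x) -` W"
        using W subspace_0 unfolding \<W>_def by auto
      ultimately have "(\<lambda>y. y - x) -` W \<inter> f ` C \<noteq> {}"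
        using open_Int_closure_eq_empty[of "(\<lambda>y. y - x) -` W" "f ` C"] x by blast
      then show ?thesis
        unfolding P_def by auto
    qed
    have "\<Inter>(P ` \<W>) \<noteq> {}"
    proof (rule linearly_compact_directed[OF U(1)])
      show "P ` \<W> \<noteq> {}"
        unfolding \<W>_def using subspace_UNIV by blast
      show "{} \<notin> P ` \<W>"
        using ne by fastforce
    next
      fix A assume "A \<in> P ` \<W>"
      then obtain W where W: "A = P W" "W \<in> \<W>"
        by auto
      then obtain v where "v \<in> C" "f v - x \<in> W"
        using ne[of W] unfolding P_def by auto
      then show "closed_linear_variety U A"
        using closed_linear_variety_preimage[OF f C] open_subspace_closed W
        unfolding P_def \<W>_def by simp
    next
      fix A B assume "A \<in> P ` \<W>" "B \<in> P ` \<W>"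
      then obtain S T where "A = P S" "B = P T" "S \<in> \<W>" "T \<in> \<W>"
        by auto
      moreover from this have "S \<inter> T \<in> \<W>"
        unfolding \<W>_def by (simp add: subspace_inter open_Int)
      ultimately show "\<exists>C\<in>P ` \<W>. C \<subseteq> A \<inter> B"
        by (intro bexI[of _ "P (S \<inter> T)"]) (auto simp: P_def)
    qed
    then obtain y where y: "y \<in> P W" if "W \<in> \<W>" for W
      by blast
    have "UNIV \<in> \<W>"
      unfolding \<W>_def by (simp add: subspace_UNIV)
    then have "y \<in> C"
      using y unfolding P_def by blast
    moreover have "f y - x = 0"
    proof (rule ccontr)
      assume "f y - x \<noteq> 0"
      then obtain W where "W \<in> \<W>" "f y - x \<notin> W"
        using separating_open_subspace[OF U] unfolding \<W>_def by blast
      then show False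
        using y unfolding P_def by blast
    qed
    ultimately show ?thesis
      by auto
  qed
  then show ?thesis
    using closure_subset_eq by blast
qed

text \<open>Open subspaces are closed, so each contains the closure of \<open>{0}\<close>;
  separation leaves only 0. This admits \<open>{0}\<close> as a closed modulus, that is, exact
  equations.\<close>

lemma closed_0:
  assumes U: "linearly_compact U" "open U"
  shows "closed {0 :: 'b}"
proof -
  have "x = 0" if "x \<in> closure {0}" for x :: 'b
  proof (rule ccontr)
    assume "x \<noteq> 0"
    then obtain W where W: "subspace W" "open W" "x \<notin> W"
      using separating_open_subspace[OF U] by blast
    then have "closure {0} \<subseteq> W"
      using open_subspace_closed subspace_0 by (intro closure_minimal) auto
    then show False
      using that W(3) by blast
  qed
  then show ?thesis
    using closure_subset_eq[of "{0 :: 'b}"] by auto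
qed

end

subsection \<open>The trajectories of a linearly compact open subspace\<close>

locale endomorphism_on_compact_open = locally_linearly_compact_space scale
  for scale :: "'k::field \<Rightarrow> 'v::topological_ab_group_add \<Rightarrow> 'v" +
  fixes \<phi> :: "'v \<Rightarrow> 'v" and U :: "'v set"
  assumes \<phi>_linear: "Vector_Spaces.linear scale scale \<phi>"
    and \<phi>_continuous: "continuous_on UNIV \<phi>"
    and U_compact: "linearly_compact U"
    and U_open: "open U"
begin

abbreviation C :: "nat \<Rightarrow> 'v set" where
  "C n \<equiv> cotrajectory n \<phi> U"

text \<open>Stage \<open>n\<close> of the decreasing sequence; its intersection is
  \<open>U_plus \<phi> U\<close>.\<close>

abbreviation Up :: "nat \<Rightarrow> 'v set" where
  "Up n \<equiv> U_seq \<phi> U n"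

lemma linear_funpow: "Vector_Spaces.linear scale scale (\<phi> ^^ n)"
proof (induction n)
  case 0
  then show ?case using linear_id by (simp add: id_def)
next
  case (Suc n)
  show ?case
    unfolding funpow.simps by (rule Vector_Spaces.linear_compose[OF Suc \<phi>_linear])
qed

lemma continuous_funpow: "continuous_on UNIV (\<phi> ^^ n)"
proof (induction n)
  case 0
  then show ?case by (simp add: id_def)
next
  case (Suc n)
  then show ?case
    using continuous_on_compose2[OF \<phi>_continuous Suc] by (simp add: o_def)
qed

lemma subspace_U: "subspace U"
  using linearly_compact_subspace[OF U_compact] .

lemma closed_U: "closed U"
  using open_subspace_closed[OF subspace_U U_open] .

lemma cotrajectory_Suc: "C (Suc n) = C n \<inter> (\<phi> ^^ n) -` U"
  unfolding cotrajectory_def lessThan_Suc by auto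

lemma subspace_cotrajectory: "subspace (C n)"
proof (induction n)
  case 0
  then show ?case by (simp add: cotrajectory_def subspace_U)
next
  case (Suc n)
  interpret f: Vector_Spaces.linear scale scale "\<phi> ^^ n"
    by (rule linear_funpow)
  show ?case
    unfolding cotrajectory_Suc using Suc f.subspace_vimage[OF subspace_U] by (rule subspace_inter)
qed

lemma open_cotrajectory: "open (C n)"
proof (induction n)
  case 0
  then show ?case by (simp add: cotrajectory_def U_open)
next
  case (Suc n)
  then show ?case
    unfolding cotrajectory_Suc using open_vimage[OF U_open continuous_funpow] by (rule open_Int)
qed

lemma cotrajectory_subset: "C n \<subseteq> U"
  unfolding cotrajectory_def by auto

text \<open>Stage \<open>n\<close> collects the endpoints of orbit segments with
  \<open>n + 1\<close> points in \<open>U\<close>, whence the shift to \<open>C (Suc n)\<close>. In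
  the induction the intersection with \<open>U\<close> is pulled back along the iterate.\<close>

lemma U_seq_eq_image: "Up n = (\<phi> ^^ n) ` C (Suc n)"
proof (induction n)
  case 0
  then show ?case by (auto simp: cotrajectory_def)
next
  case (Suc n)
  have "Up (Suc n) = U \<inter> (\<phi> ^^ Suc n) ` C (Suc n)"
    using Suc by (simp add: image_comp)
  also have "\<dots> = (\<phi> ^^ Suc n) ` (C (Suc n) \<inter> (\<phi> ^^ Suc n) -` U)"
    by auto
  finally show ?case
    unfolding cotrajectory_Suc[of "Suc n"] .
qed

lemma image_U_seq: "\<phi> ` Up n = (\<phi> ^^ Suc n) ` C (Suc n)"
  unfolding U_seq_eq_image by (simp add: image_comp)

lemma subspace_U_seq: "subspace (Up n)"
proof -
  interpret f: Vector_Spaces.linear scale scale "\<phi> ^^ n"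
    by (rule linear_funpow)
  show ?thesis
    unfolding U_seq_eq_image by (rule f.subspace_image[OF subspace_cotrajectory])
qed

text \<open>The cotrajectory is an open, hence closed, subspace of \<open>U\<close>, and its image
  under an iterate of \<phi> is closed by linear compactness.\<close>

lemma closed_U_seq: "closed (Up n)"
  unfolding U_seq_eq_image
  by (intro closed_image_subspace[OF U_compact U_open] linear_funpow continuous_funpow
      subspace_cotrajectory cotrajectory_subset open_subspace_closed open_cotrajectory)

lemma U_seq_subset: "Up n \<subseteq> U"
  by (cases n) auto

lemma decseq_U_seq: "decseq Up"
proof (rule decseq_SucI)
  fix n
  show "Up (Suc n) \<subseteq> Up n"
    by (induction n) auto
qed

lemma subspace_U_plus: "subspace (U_plus \<phi> U)"
  unfolding U_plus_def using subspace_U_seq by (auto intro: subspace_Inter)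

text \<open>Used with \<open>W = {0}\<close> to find preimages in \<open>U_plus \<phi> U\<close>,
  and with \<open>W = U\<close> to identify the stationary value of \<phi>\<open>Up n\<close> +
  \<open>U\<close>.\<close>

lemma U_plus_compactness:
  assumes W: "subspace W" "closed W" and ex: "\<And>n. \<exists>z\<in>Up n. \<phi> z - x \<in> W"
  shows "\<exists>z\<in>U_plus \<phi> U. \<phi> z - x \<in> W"
  unfolding U_plus_def
  by (intro linearly_compact_decreasing_preimage[OF U_compact \<phi>_linear \<phi>_continuous]
      subspace_U_seq closed_U_seq U_seq_subset decseq_U_seq W ex)

lemma image_U_plus_Int: "\<phi> ` U_plus \<phi> U \<inter> U = U_plus \<phi> U"
proof (intro subset_antisym subsetI)
  fix x assume x: "x \<in> \<phi> ` U_plus \<phi> U \<inter> U"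
  then have "x \<in> Up n" for n
    by (cases n) (auto simp: U_plus_def)
  then show "x \<in> U_plus \<phi> U"
    unfolding U_plus_def by auto
next
  fix x assume x: "x \<in> U_plus \<phi> U"
  \<comment> \<open>Membership in stage \<open>n + 1\<close> provides a preimage in stage
    \<open>n\<close>; compactness then finds one lying in all stages.\<close>
  have "\<exists>z\<in>Up n. \<phi> z - x \<in> {0}" for n
  proof -
    have "x \<in> Up (Suc n)"
      using x unfolding U_plus_def by blast
    then show ?thesis
      by auto
  qed
  then have "\<exists>z\<in>U_plus \<phi> U. \<phi> z - x \<in> {0}"
    by (intro U_plus_compactness subspace_single_0 closed_0[OF U_compact U_open])
  moreover have "x \<in> U"
    using x U_seq_subset[of 0] unfolding U_plus_def by blast
  ultimately show "x \<in> \<phi> ` U_plus \<phi> U \<inter> U"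
    by auto
qed

text \<open>Apply \<open>quotient_dim_image\<close> to the iterate of order \<open>n + 1\<close>,
  then the second isomorphism theorem. The count starts at \<open>C 1\<close>, which equals
  \<open>U\<close>, as does \<open>C 0\<close>.\<close>

lemma quotient_dim_cotrajectory_Suc:
  "quotient_dim (C (Suc n)) (C (Suc (Suc n))) = quotient_dim (span (\<phi> ` Up n \<union> U)) U"
proof -
  interpret f: Vector_Spaces.linear scale scale "\<phi> ^^ Suc n"
    by (rule linear_funpow)
  have sub: "subspace (\<phi> ` Up n)"
    unfolding image_U_seq by (rule f.subspace_image[OF subspace_cotrajectory])
  have "C (Suc (Suc n)) = C (Suc n) \<inter> (\<phi> ^^ Suc n) -` (\<phi> ` Up n \<inter> U)"
    unfolding cotrajectory_Suc[of "Suc n"] image_U_seq by blast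
  then have "quotient_dim (C (Suc n)) (C (Suc (Suc n))) = quotient_dim (\<phi> ` Up n) (\<phi> ` Up n \<inter> U)"
    using quotient_dim_image[OF linear_funpow subspace_cotrajectory subspace_inter[OF sub subspace_U],
        of "Suc n" "Suc n"]
    unfolding image_U_seq by simp
  then show ?thesis
    unfolding quotient_dim_sum[OF sub subspace_U] .
qed

lemma quotient_dim_cotrajectory_finite: "quotient_dim U (C n) \<noteq> \<infinity>"
  using linearly_compact_open_finite_codim[OF U_compact]
    subspace_cotrajectory open_cotrajectory cotrajectory_subset by blast

lemma quotient_dim_U_cotrajectory_Suc:
  "quotient_dim U (C (Suc (Suc n)))
    = quotient_dim U (C (Suc n)) + quotient_dim (span (\<phi> ` Up n \<union> U)) U"
  unfolding quotient_dim_cotrajectory_Suc[symmetric]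
  by (intro quotient_dim_trans subspace_U subspace_cotrajectory cotrajectory_subset)
    (auto simp: cotrajectory_Suc[of "Suc n"])

lemma span_image_U_seq_antimono:
  "m \<le> n \<Longrightarrow> span (\<phi> ` Up n \<union> U) \<subseteq> span (\<phi> ` Up m \<union> U)"
  using decseqD[OF decseq_U_seq, of m n] by (intro span_mono) auto

text \<open>It is a summand of the finite codimension of \<open>C (Suc (Suc n))\<close> in
  \<open>U\<close>.\<close>

lemma quotient_dim_span_image_finite: "quotient_dim (span (\<phi> ` Up n \<union> U)) U \<noteq> \<infinity>"
  using quotient_dim_U_cotrajectory_Suc[of n] quotient_dim_cotrajectory_finite[of "Suc (Suc n)"]
  by (auto simp: plus_eq_infty_iff_enat)

lemma span_image_U_seq_stationary:
  "\<exists>N. \<forall>n\<ge>N. span (\<phi> ` Up n \<union> U) = span (\<phi> ` Up N \<union> U)"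
proof -
  define S where "S n = span (\<phi> ` Up n \<union> U)" for n
  have sS: "subspace (S n)" "U \<subseteq> S n" for n
    unfolding S_def using span_superset[of "\<phi> ` Up n \<union> U"] by auto
  \<comment> \<open>\<open>enat\<close> is well-ordered, so some stage attains the least dimension.
    Later stages are contained in it, and finiteness allows cancelling in the additivity
    formula.\<close>
  obtain N where N: "\<And>n. quotient_dim (S N) U \<le> quotient_dim (S n) U"
    using exists_least_iff[of "\<lambda>d. \<exists>n. quotient_dim (S n) U = d"] by (metis not_le)
  have "S n = S N" if "N \<le> n" for n
  proof -
    have sub: "S n \<subseteq> S N"
      unfolding S_def using span_image_U_seq_antimono[OF that] .
    have "quotient_dim (S N) U = quotient_dim (S N) (S n) + quotient_dim (S n) U"
      by (intro quotient_dim_trans sS subspace_U sub)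
    moreover have "quotient_dim (S N) U \<noteq> \<infinity>"
      unfolding S_def by (rule quotient_dim_span_image_finite)
    ultimately have "quotient_dim (S N) (S n) = 0"
      using N[of n]
      by (cases "quotient_dim (S N) (S n)"; cases "quotient_dim (S n) U") (auto simp: zero_enat_def)
    then show ?thesis
      using quotient_dim_eq_0[OF sS(1) sS(1) sub] by simp
  qed
  then show ?thesis
    unfolding S_def by blast
qed

text \<open>A vector of the stationary value agrees modulo \<open>U\<close> with an image from every
  stage. As \<open>U\<close> is closed, compactness yields one preimage in
  \<open>U_plus \<phi> U\<close>.\<close>

lemma span_image_U_plus:
  assumes N: "\<And>n. N \<le> n \<Longrightarrow> span (\<phi> ` Up n \<union> U) = span (\<phi> ` Up N \<union> U)"
  shows "span (\<phi> ` U_plus \<phi> U \<union> U) = span (\<phi> ` Up N \<union> U)"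
proof (intro subset_antisym subsetI)
  show "x \<in> span (\<phi> ` Up N \<union> U)" if "x \<in> span (\<phi> ` U_plus \<phi> U \<union> U)" for x
    using that by (rule span_mono[THEN subsetD, rotated]) (auto simp: U_plus_def)
next
  interpret f: Vector_Spaces.linear scale scale \<phi>
    by (rule \<phi>_linear)
  fix x assume x: "x \<in> span (\<phi> ` Up N \<union> U)"
  have "\<exists>z\<in>Up n. \<phi> z - x \<in> U" for n
  proof -
    \<comment> \<open>Stationarity holds only from \<open>N\<close> on; a preimage in the later
      stage \<open>max n N\<close> also lies in stage \<open>n\<close>.\<close>
    have "x \<in> span (\<phi> ` Up (max n N) \<union> U)"
      using x N[of "max n N"] by simp
    then obtain y u where y: "y \<in> span (\<phi> ` Up (max n N))" "u \<in> span U" "x = y + u"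
      unfolding span_Un by auto
    have "span (\<phi> ` Up (max n N)) = \<phi> ` Up (max n N)" "span U = U"
      using f.subspace_image[OF subspace_U_seq] subspace_U span_eq_iff by blast+
    then obtain z where z: "z \<in> Up (max n N)" "x = \<phi> z + u" "u \<in> U"
      using y by (simp only: image_iff) blast
    then have "z \<in> Up n" "\<phi> z - x \<in> U"
      using decseqD[OF decseq_U_seq, of n "max n N"] subspace_neg[OF subspace_U] by auto
    then show ?thesis
      by blast
  qed
  then obtain z where z: "z \<in> U_plus \<phi> U" "\<phi> z - x \<in> U"
    using U_plus_compactness[OF subspace_U closed_U, of x] by blast
  have "\<phi> z - (\<phi> z - x) \<in> span (\<phi> ` U_plus \<phi> U \<union> U)"
    using z by (intro span_diff[OF span_base span_base]) auto
  then show "x \<in> span (\<phi> ` U_plus \<phi> U \<union> U)"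
    by simp
qed

text \<open>From \<open>N\<close> on the codimension grows by the constant \<gamma> at each step, so
  it is affine in the index with slope \<gamma>.\<close>

lemma codim_rate_tendsto:
  "codim_rate \<phi> U \<longlonglongrightarrow> ereal_of_enat (quotient_dim (\<phi> ` U_plus \<phi> U) (U_plus \<phi> U))"
proof -
  interpret f: Vector_Spaces.linear scale scale \<phi>
    by (rule \<phi>_linear)
  obtain N where N: "\<And>n. N \<le> n \<Longrightarrow> span (\<phi> ` Up n \<union> U) = span (\<phi> ` Up N \<union> U)"
    using span_image_U_seq_stationary by blast
  obtain \<gamma> where \<gamma>: "quotient_dim (span (\<phi> ` Up N \<union> U)) U = enat \<gamma>"
    using quotient_dim_span_image_finite by blast
  have "quotient_dim (\<phi> ` U_plus \<phi> U) (U_plus \<phi> U) = quotient_dim (span (\<phi> ` U_plus \<phi> U \<union> U)) U"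
    using quotient_dim_sum[OF f.subspace_image[OF subspace_U_plus] subspace_U]
    unfolding image_U_plus_Int by simp
  also have "\<dots> = enat \<gamma>"
    using span_image_U_plus[OF N] \<gamma> by simp
  finally have lim: "quotient_dim (\<phi> ` U_plus \<phi> U) (U_plus \<phi> U) = enat \<gamma>" .
  have "\<forall>n. \<exists>d. quotient_dim U (C (Suc n)) = enat d"
    using quotient_dim_cotrajectory_finite by blast
  then obtain d where d: "\<And>n. quotient_dim U (C (Suc n)) = enat (d n)"
    by metis
  have dN: "real (d n) = real (d N) + (real n - real N) * real \<gamma>" if "N \<le> n" for n
    using that
  proof (induction n rule: dec_induct)
    case (step n)
    have "enat (d (Suc n)) = enat (d n) + enat \<gamma>"
      using quotient_dim_U_cotrajectory_Suc[of n] N[OF step.hyps(1)] \<gamma> d by simp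
    then show ?case
      using step.IH by (simp add: algebra_simps)
  qed simp
  \<comment> \<open>Chosen so that \<open>d n\<close> equals \<gamma> times \<open>n + 1\<close>
    plus \<open>a\<close>: the rate at \<open>Suc n\<close> divides by \<open>n + 1\<close>, which
    accounts for the last summand. Working at \<open>Suc n\<close> also avoids division by
    0.\<close>
  define a where "a = real (d N) - real N * real \<gamma> - real \<gamma>"
  have rate: "codim_rate \<phi> U (Suc n) = ereal (real \<gamma> + a / real (Suc n))" if "N \<le> n" for n
    using dN[OF that] unfolding codim_rate_def d a_def by (simp add: field_simps)
  have "(\<lambda>n. real \<gamma> + a / real (Suc n)) \<longlonglongrightarrow> real \<gamma> + 0"
    by (intro tendsto_add tendsto_const LIMSEQ_Suc lim_const_over_n)
  then have "(\<lambda>n. ereal (real \<gamma> + a / real (Suc n))) \<longlonglongrightarrow> ereal (real \<gamma>)"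
    by simp
  then have "(\<lambda>n. codim_rate \<phi> U (Suc n)) \<longlonglongrightarrow> ereal (real \<gamma>)"
    by (rule Lim_transform_eventually)
      (auto simp: eventually_sequentially rate simp del: of_nat_Suc intro!: exI[of _ N])
  then show ?thesis
    unfolding lim by (simp add: LIMSEQ_imp_Suc)
qed

end

theorem proposition3p19:
  fixes scale :: "'k::field \<Rightarrow> 'v::topological_ab_group_add \<Rightarrow> 'v"
    and \<phi> :: "'v \<Rightarrow> 'v" and U :: "'v set"
  assumes V: "locally_linearly_compact_space scale"
    and \<phi>_linear: "Vector_Spaces.linear scale scale \<phi>"
    and \<phi>_continuous: "continuous_on UNIV \<phi>"
    and U_compact: "topological_vector_space.linearly_compact scale U"
    and U_open: "open U"
  shows "convergent (topological_vector_space.codim_rate scale \<phi> U) \<and>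
    U_plus \<phi> U \<subseteq> \<phi> ` U_plus \<phi> U \<and>
    topological_vector_space.H_star scale \<phi> U
      = ereal_of_enat (topological_vector_space.quotient_dim scale (\<phi> ` U_plus \<phi> U) (U_plus \<phi> U))"
proof -
  interpret endomorphism_on_compact_open scale \<phi> U
    using assms
    by (intro endomorphism_on_compact_open.intro endomorphism_on_compact_open_axioms.intro)
  show ?thesis
    \<comment> \<open>The limit statement gives both convergence and the value of \<open>lim\<close>
      in \<open>H_star\<close>; the inclusion is read off from
      \<open>image_U_plus_Int\<close>.\<close>
    using codim_rate_tendsto limI[OF codim_rate_tendsto] image_U_plus_Int
    unfolding H_star_def by (auto intro: convergentI)
qed

end
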